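(* Let $h>0$. For each function $u:\Omega_h\to\mathbb R^3$ (not necessarily vanishing on $\partial\Omega_h$) there exist unique functions $w:\Omega_h\to\mathbb R^3$ and $\phi:\Omega_h\to\mathbb R$ such that $$\mathcal D\cdot w=0\ \text{ and }\ w+\mathcal D\phi=u\ \text{ on }\Omega_h\setminus\partial\Omega_h;\qquad w=0\ \text{ and }\ \phi=0\ \text{ on }\partial\Omega_h.$$
   Context: $\Omega\subset\mathbb R^3$ is a bounded connected open set with Lipschitz boundary. For $h>0$ let $h\mathbb Z^3=\{(hz_1,hz_2,hz_3): z_i\in\mathbb Z\}$; $e^1,e^2,e^3$ is the standard basis of $\mathbb R^3$. For $B\subset h\mathbb Z^3$, $\partial B:=\{x\in B:\{x\pm he^i: i=1,2,3\}\not\subset B\}$. $C_h(x):=\prod_{i=1}^3[x_i-\frac h2,x_i+\frac h2)$ and $\Omega_h:=\{x\in\Omega\cap h\mathbb Z^3: C_{4h}(x)\subset\Omega\}$. Functions on $\Omega_h$ are always extended by $0$ outside $\Omega_h$, and $D_i^+\phi(x)=\frac{\phi(x+he^i)-\phi(x)}h$, $D_i^-\phi(x)=\frac{\phi(x)-\phi(x-he^i)}h$. The discrete gradient is $\mathcal D\phi=(D_1^+\phi,D_2^+\phi,D_3^+\phi)$ (forward differences) and the discrete divergence is $\mathcal D\cdot w=D_1^-w_1+D_2^-w_2+D_3^-w_3$ (backward differences). *)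

theory Defs
  imports "HOL-Analysis.Analysis"
begin

text \<open>Near each boundary point, after an isometric change of Cartesian coordinates centred at that
  point, the set is the strict epigraph of a Lipschitz function of the first two coordinates.\<close>

definition lipschitz_boundary :: "(real^3) set \<Rightarrow> bool" where
  "lipschitz_boundary \<Omega> \<longleftrightarrow>
     (\<forall>p \<in> frontier \<Omega>. \<exists>r>0. \<exists>T :: real^3 \<Rightarrow> real^3. \<exists>\<gamma> :: real^2 \<Rightarrow> real. \<exists>L.
        orthogonal_transformation T \<and> L-lipschitz_on UNIV \<gamma> \<and>
        \<Omega> \<inter> ball p r =
          {x \<in> ball p r. \<gamma> (vector [T (x - p) $ 1, T (x - p) $ 2]) < T (x - p) $ 3})"

definition grid :: "real \<Rightarrow> (real^3) set" where
  "grid h = range (\<lambda>z :: int^3. \<chi> i. h * of_int (z $ i))"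

definition grid_boundary :: "real \<Rightarrow> (real^3) set \<Rightarrow> (real^3) set" where
  "grid_boundary h B =
     {x \<in> B. \<not> (\<Union>i. {x + h *\<^sub>R axis i 1, x - h *\<^sub>R axis i 1}) \<subseteq> B}"

definition cube :: "real \<Rightarrow> real^3 \<Rightarrow> (real^3) set" where
  "cube h x = {y. \<forall>i. x $ i - h / 2 \<le> y $ i \<and> y $ i < x $ i + h / 2}"

definition grid_domain :: "real \<Rightarrow> (real^3) set \<Rightarrow> (real^3) set" where
  "grid_domain h \<Omega> = {x \<in> \<Omega> \<inter> grid h. cube (4 * h) x \<subseteq> \<Omega>}"

text \<open>A function on \<open>S\<close>, extended by zero outside \<open>S\<close>, is a total function vanishing off \<open>S\<close>.
  This makes equality of total functions the same as equality on \<open>S\<close>.\<close>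

definition zero_extended :: "(real^3) set \<Rightarrow> (real^3 \<Rightarrow> 'b::zero) set" where
  "zero_extended S = {f. \<forall>x. x \<notin> S \<longrightarrow> f x = 0}"

definition fwd_diff :: "real \<Rightarrow> 3 \<Rightarrow> (real^3 \<Rightarrow> real) \<Rightarrow> real^3 \<Rightarrow> real" where
  "fwd_diff h i \<phi> x = (\<phi> (x + h *\<^sub>R axis i 1) - \<phi> x) / h"

definition bwd_diff :: "real \<Rightarrow> 3 \<Rightarrow> (real^3 \<Rightarrow> real) \<Rightarrow> real^3 \<Rightarrow> real" where
  "bwd_diff h i \<phi> x = (\<phi> x - \<phi> (x - h *\<^sub>R axis i 1)) / h"

definition discrete_grad :: "real \<Rightarrow> (real^3 \<Rightarrow> real) \<Rightarrow> real^3 \<Rightarrow> real^3" where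
  "discrete_grad h \<phi> x = (\<chi> i. fwd_diff h i \<phi> x)"

definition discrete_div :: "real \<Rightarrow> (real^3 \<Rightarrow> real^3) \<Rightarrow> real^3 \<Rightarrow> real" where
  "discrete_div h w x = (\<Sum>i\<in>UNIV. bwd_diff h i (\<lambda>y. w y $ i) x)"

end

theory Submission
  imports Defs "HOL-Library.Function_Algebras"
begin

text \<open>Let \<open>I\<close> be the interior of the grid domain. The boundary conditions force \<open>\<phi>\<close> to be
  supported on \<open>I\<close> and \<open>w\<close> to be \<open>u - \<D>\<phi>\<close> cut off to \<open>I\<close>, so that only the square linear system
  \<open>\<D> \<cdot> (1\<^sub>I \<D>\<phi>) = \<D> \<cdot> (1\<^sub>I u)\<close> on \<open>I\<close> remains. Summation by parts gives
  \<open>\<Sum>\<^sub>I \<phi> \<D> \<cdot> (1\<^sub>I \<D>\<phi>) = - \<Sum>\<^sub>I |\<D>\<phi>|\<^sup>2\<close>, so a solution of the homogeneous system is constant along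
  each forward step starting in \<open>I\<close>; since such a walk leaves the finite set \<open>I\<close>, it vanishes.
  The system is therefore uniquely solvable.\<close>

text \<open>\<open>T\<close> maps a basis \<open>C\<close> of \<open>span B\<close> to an
  independent set of the same size. A vector of \<open>C\<close> outside the span of that image
  could be added to it, giving an independent subset of \<open>span C\<close> with more than
  \<open>card C\<close> elements.\<close>

lemma (in vector_space) linear_inj_on_span_imp_image_eq:
  assumes T: "Vector_Spaces.linear scale scale T"
    and B: "finite B" "inj_on T (span B)" "T ` span B \<subseteq> span B"
  shows "T ` span B = span B"
proof -
  interpret T: Vector_Spaces.linear scale scale T by (rule T)
  obtain C where C: "C \<subseteq> B" "independent C" "span B \<subseteq> span C"
    using maximal_independent_subset[of B] span_mono span_span
    by (metis span_minimal subspace_span)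
  have "finite C" using C(1) B(1) finite_subset by blast
  have spC: "span C = span B" using C span_mono by blast
  have injC: "inj_on T C" using B(2) spC span_superset inj_on_subset by metis
  have indT: "independent (T ` C)"
    using T.independent_injective_image[OF C(2)] B(2) spC by simp
  have "T ` C \<subseteq> span C" using B(3) spC span_superset by blast
  have "C \<subseteq> span (T ` C)"
  proof
    fix c assume "c \<in> C"
    show "c \<in> span (T ` C)"
    proof (rule ccontr)
      assume c: "c \<notin> span (T ` C)"
      then have "independent (insert c (T ` C))" using indT independent_insertI by blast
      moreover have "insert c (T ` C) \<subseteq> span C"
        using \<open>T ` C \<subseteq> span C\<close> \<open>c \<in> C\<close> span_base by blast
      ultimately have "card (insert c (T ` C)) \<le> card C"
        using independent_span_bound \<open>finite C\<close> by blast
      moreover have "c \<notin> T ` C" using c span_base[of c "T ` C"] by blast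
      ultimately show False using \<open>finite C\<close> card_image[OF injC] by simp
    qed
  qed
  then have "span C \<subseteq> T ` span C"
    by (metis T.span_image span_minimal subspace_span)
  then show ?thesis using B(3) spC by (simp add: subset_antisym)
qed

text \<open>Functions supported in \<open>A\<close> are spanned by the finitely many point
  indicators \<open>e a\<close>, so on them a trivial kernel forces surjectivity.\<close>

lemma finite_support_inj_imp_surj:
  fixes T :: "('a \<Rightarrow> real) \<Rightarrow> 'a \<Rightarrow> real"
  assumes A: "finite A"
    and add: "\<And>f g. T (\<lambda>x. f x + g x) = (\<lambda>x. T f x + T g x)"
    and scale: "\<And>c f. T (\<lambda>x. c * f x) = (\<lambda>x. c * T f x)"
    and maps: "\<And>f x. x \<notin> A \<Longrightarrow> T f x = 0"
    and ker: "\<And>f. (\<forall>x. x \<notin> A \<longrightarrow> f x = 0) \<Longrightarrow> T f = (\<lambda>x. 0) \<Longrightarrow> f = (\<lambda>x. 0)"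
    and g: "\<forall>x. x \<notin> A \<longrightarrow> g x = 0"
  obtains f where "\<forall>x. x \<notin> A \<longrightarrow> f x = 0" "T f = g"
proof -
  define sc where "sc = (\<lambda>(c::real) (f::'a \<Rightarrow> real) x. c * f x)"
  interpret vector_space sc
    by unfold_locales (auto simp: sc_def fun_eq_iff algebra_simps)
  have lin: "Vector_Spaces.linear sc sc T"
    by unfold_locales (auto simp: sc_def plus_fun_def add scale)
  define V where "V = {f :: 'a \<Rightarrow> real. \<forall>x. x \<notin> A \<longrightarrow> f x = 0}"
  define e :: "'a \<Rightarrow> 'a \<Rightarrow> real" where "e = (\<lambda>a x. if x = a then 1 else 0)"
  have "subspace V" by (rule subspaceI) (auto simp: V_def sc_def)
  moreover have "e ` A \<subseteq> V" by (auto simp: e_def V_def)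
  ultimately have "span (e ` A) \<subseteq> V" by (rule span_minimal[rotated])
  moreover have "V \<subseteq> span (e ` A)"
  proof
    fix f assume f: "f \<in> V"
    \<comment> \<open>The sum is formed in the function space; induction on \<open>B\<close> moves
      the evaluation at \<open>x\<close> inside.\<close>
    have sum_at: "(\<Sum>a\<in>B. sc (f a) (e a)) x = (\<Sum>a\<in>B. sc (f a) (e a) x)" if "finite B" for B x
      using that by induction auto
    have "(\<Sum>a\<in>A. sc (f a) (e a)) x = f x" for x
      using f A by (simp add: sum_at, simp add: sc_def e_def V_def if_distrib cong: if_cong)
    then have "f = (\<Sum>a\<in>A. sc (f a) (e a))" by auto
    moreover have "(\<Sum>a\<in>A. sc (f a) (e a)) \<in> span (e ` A)"
      by (intro span_sum span_scale span_base) auto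
    ultimately show "f \<in> span (e ` A)" by simp
  qed
  ultimately have V: "span (e ` A) = V" by blast
  have "inj_on T V"
  proof
    fix f1 f2 assume f: "f1 \<in> V" "f2 \<in> V" "T f1 = T f2"
    \<comment> \<open>The difference is written with the factor \<open>-1\<close> so that
      \<open>add\<close> and \<open>scale\<close> apply literally.\<close>
    have "T (\<lambda>x. f1 x + (-1) * f2 x) = (\<lambda>x. 0)"
      unfolding add scale f(3) by simp
    then have "(\<lambda>x. f1 x + (-1) * f2 x) = (\<lambda>x. 0)"
      using f by (intro ker[of "\<lambda>x. f1 x + (-1) * f2 x"]) (simp_all add: V_def)
    then show "f1 = f2" by (auto simp: fun_eq_iff)
  qed
  moreover have "T ` V \<subseteq> V" using maps by (auto simp: V_def)
  ultimately have "T ` V = V"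
    using linear_inj_on_span_imp_image_eq[OF lin, of "e ` A"] A by (simp add: V)
  moreover have "g \<in> V" using g by (simp add: V_def)
  ultimately obtain f where "f \<in> V" "T f = g" by (metis imageE)
  then show thesis using that by (simp add: V_def)
qed

lemma finite_grid_domain:
  assumes "bounded \<Omega>" "h > 0"
  shows "finite (grid_domain h \<Omega>)"
proof -
  obtain R where R: "norm x \<le> R" if "x \<in> \<Omega>" for x
    using assms(1) by (auto simp: bounded_iff)
  \<comment> \<open>If \<open>x = h z\<close> has norm at most \<open>R\<close>, every integer
    coordinate of \<open>z\<close> is at most \<open>R / h\<close> in absolute value.\<close>
  define N where "N = \<lceil>R / h\<rceil>"
  let ?Z = "vec_lambda ` (UNIV \<rightarrow>\<^sub>E {-N..N}) :: (int^3) set"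
  have "grid_domain h \<Omega> \<subseteq> (\<lambda>z. \<chi> i. h * of_int (z $ i)) ` ?Z"
  proof
    fix x assume "x \<in> grid_domain h \<Omega>"
    then obtain z :: "int^3" where z: "x = (\<chi> i. h * of_int (z $ i))" and "x \<in> \<Omega>"
      by (auto simp: grid_domain_def grid_def)
    have "\<bar>z $ i\<bar> \<le> N" for i
    proof -
      have "\<bar>x $ i\<bar> \<le> R" using R[OF \<open>x \<in> \<Omega>\<close>] component_le_norm_cart[of x i] by linarith
      then have "\<bar>of_int (z $ i)\<bar> * h \<le> R" using assms(2) by (simp add: z abs_mult mult.commute)
      then have "of_int \<bar>z $ i\<bar> \<le> R / h" using assms(2) by (simp add: field_simps)
      then show ?thesis unfolding N_def by linarith
    qed
    then have "\<forall>i. z $ i \<in> {-N..N}" by (metis abs_le_iff atLeastAtMost_iff minus_le_iff)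
    then have "vec_nth z \<in> UNIV \<rightarrow>\<^sub>E {-N..N}" by (auto simp: PiE_def)
    then have "z \<in> ?Z" by (metis imageI vec_nth_inverse)
    then show "x \<in> (\<lambda>z. \<chi> i. h * of_int (z $ i)) ` ?Z" using z by blast
  qed
  moreover have "finite ?Z" by (intro finite_imageI finite_PiE) auto
  ultimately show ?thesis by (meson finite_imageI finite_subset)
qed

text \<open>Both functions vanish off \<open>I\<close>, so no boundary terms arise.\<close>

lemma sum_bwd_diff_by_parts:
  fixes \<phi> v :: "real^3 \<Rightarrow> real"
  assumes "finite I" and "\<forall>x. x \<notin> I \<longrightarrow> \<phi> x = 0" and "\<forall>x. x \<notin> I \<longrightarrow> v x = 0"
  shows "(\<Sum>x\<in>I. \<phi> x * bwd_diff h i v x) = - (\<Sum>x\<in>I. v x * fwd_diff h i \<phi> x)"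
proof -
  define d :: "real^3" where "d = h *\<^sub>R axis i 1"
  \<comment> \<open>The shift by \<open>d\<close> need not preserve \<open>I\<close>, but a nonzero
    term has both its points in \<open>I\<close>. Terms whose shifted point leaves \<open>I\<close>
    are zero and fall into the exceptional sets \<open>S'\<close> and \<open>T'\<close>.\<close>
  have "(\<Sum>x\<in>I. \<phi> x * v (x - d)) = (\<Sum>x\<in>I. v x * \<phi> (x + d))"
    by (rule sum.reindex_bij_witness_not_neutral
        [where S' = "{x\<in>I. \<phi> x * v (x - d) = 0}"
          and T' = "{x\<in>I. v x * \<phi> (x + d) = 0}"
          and i = "\<lambda>x. x + d" and j = "\<lambda>x. x - d"])
      (use assms in auto)
  then have "(\<Sum>x\<in>I. \<phi> x * (v x - v (x - d))) = - (\<Sum>x\<in>I. v x * (\<phi> (x + d) - \<phi> x))"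
    by (simp add: right_diff_distrib sum_subtractf mult.commute)
  then show ?thesis
    by (simp add: bwd_diff_def fwd_diff_def flip: d_def sum_divide_distrib)
qed

text \<open>One direction suffices: a nonzero value puts its point in \<open>I\<close>, where the
  zero difference copies it to the next point, so \<open>I\<close> would contain an infinite
  ray.\<close>

lemma fwd_diff_eq_0_imp_eq_0:
  assumes "finite I" "h > 0" and supp: "\<forall>x. x \<notin> I \<longrightarrow> \<phi> x = 0"
    and diff: "\<forall>x\<in>I. fwd_diff h i \<phi> x = 0"
  shows "\<phi> x = 0"
proof (rule ccontr)
  assume nz: "\<phi> x \<noteq> 0"
  define p :: "nat \<Rightarrow> real^3" where "p n = x + (of_nat n * h) *\<^sub>R axis i 1" for n
  have "\<phi> (p n) = \<phi> x" for n
  proof (induction n)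
    case (Suc n)
    have "p n \<in> I" using Suc nz supp by auto
    moreover have "p (Suc n) = p n + h *\<^sub>R axis i 1"
      by (simp add: p_def algebra_simps)
    ultimately show ?case using diff assms(2) Suc by (force simp: fwd_diff_def)
  qed (simp add: p_def)
  then have "range p \<subseteq> I" using nz supp by (metis image_subsetI)
  moreover have "inj p" using assms(2) by (auto simp: inj_def p_def axis_eq_0_iff)
  ultimately show False using assms(1) finite_subset finite_imageD infinite_UNIV_nat by metis
qed

text \<open>The cut-off encodes \<open>w = 0\<close> off \<open>I\<close>: the backward divergence
  at a point of \<open>I\<close> may read values outside \<open>I\<close>, and these must be
  zero.\<close>

definition restrict_grad :: "real \<Rightarrow> (real^3) set \<Rightarrow> (real^3 \<Rightarrow> real) \<Rightarrow> real^3 \<Rightarrow> real^3" where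
  "restrict_grad h I \<phi> x = (if x \<in> I then discrete_grad h \<phi> x else 0)"

lemma discrete_div_grad_eq_0_imp_eq_0:
  assumes "finite I" "h > 0" and supp: "\<forall>x. x \<notin> I \<longrightarrow> \<phi> x = 0"
    and div: "\<forall>x\<in>I. discrete_div h (restrict_grad h I \<phi>) x = 0"
  shows "\<phi> = (\<lambda>x. 0)"
proof -
  have "0 = (\<Sum>x\<in>I. \<phi> x * discrete_div h (restrict_grad h I \<phi>) x)"
    using div by simp
  also have "\<dots> = (\<Sum>i\<in>UNIV. \<Sum>x\<in>I. \<phi> x * bwd_diff h i (\<lambda>y. restrict_grad h I \<phi> y $ i) x)"
    unfolding discrete_div_def sum_distrib_left by (rule sum.swap)
  \<comment> \<open>The cut-off field vanishes off \<open>I\<close>, as summation by parts requires,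
    and on \<open>I\<close> it is the gradient itself, so squares appear next.\<close>
  also have "\<dots> = (\<Sum>i\<in>UNIV. - (\<Sum>x\<in>I. restrict_grad h I \<phi> x $ i * fwd_diff h i \<phi> x))"
    using assms by (intro sum.cong refl sum_bwd_diff_by_parts) (auto simp: restrict_grad_def)
  also have "\<dots> = - (\<Sum>i\<in>UNIV. \<Sum>x\<in>I. (fwd_diff h i \<phi> x)\<^sup>2)"
    by (simp add: restrict_grad_def discrete_grad_def sum_negf power2_eq_square)
  finally have "(\<Sum>i\<in>UNIV. \<Sum>x\<in>I. (fwd_diff h i \<phi> x)\<^sup>2) = 0" by simp
  then have "\<forall>i. \<forall>x\<in>I. fwd_diff h i \<phi> x = 0"
    using assms(1) by (simp add: sum_nonneg_eq_0_iff sum_nonneg)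
  then show ?thesis using fwd_diff_eq_0_imp_eq_0[OF assms(1,2) supp] by blast
qed

lemma discrete_div_diff:
  "discrete_div h (\<lambda>y. v y - w y) x = discrete_div h v x - discrete_div h w x"
  by (simp add: discrete_div_def bwd_diff_def sum_subtractf[symmetric] diff_divide_distrib)
     (simp add: algebra_simps)

lemma discrete_div_grad_surj:
  assumes "finite I" "h > 0"
  obtains \<phi> where "\<forall>x. x \<notin> I \<longrightarrow> \<phi> x = 0"
    "\<forall>x\<in>I. discrete_div h (restrict_grad h I \<phi>) x = g x"
proof -
  \<comment> \<open>Truncation to \<open>I\<close> makes \<open>T\<close> an endomorphism of the
    functions supported in \<open>I\<close>; the right-hand side \<open>g\<close> is truncated
    likewise below.\<close>
  define T where
    "T \<phi> x = (if x \<in> I then discrete_div h (restrict_grad h I \<phi>) x else 0)" for \<phi> x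
  \<comment> \<open>Linearity is stated by components, the form in which \<open>bwd_diff\<close>
    meets the field once \<open>discrete_div\<close> is unfolded.\<close>
  have grad_add: "restrict_grad h I (\<lambda>x. f x + g x) y $ i
      = restrict_grad h I f y $ i + restrict_grad h I g y $ i" for f g y i
    by (simp add: restrict_grad_def discrete_grad_def fwd_diff_def add_divide_distrib[symmetric])
  have grad_scale: "restrict_grad h I (\<lambda>x. c * f x) y $ i = c * restrict_grad h I f y $ i"
    for c f y i
    by (simp add: restrict_grad_def discrete_grad_def fwd_diff_def right_diff_distrib)
  have bwd_add: "bwd_diff h i (\<lambda>y. f y + g y) x = bwd_diff h i f x + bwd_diff h i g x"
    and bwd_scale: "bwd_diff h i (\<lambda>y. c * f y) x = c * bwd_diff h i f x" for i f g x c
    by (simp_all add: bwd_diff_def add_divide_distrib[symmetric] right_diff_distrib)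
  obtain \<phi> where "\<forall>x. x \<notin> I \<longrightarrow> \<phi> x = 0" "T \<phi> = (\<lambda>x. if x \<in> I then g x else 0)"
  proof (rule finite_support_inj_imp_surj[of I T "\<lambda>x. if x \<in> I then g x else 0"])
    show "f = (\<lambda>x. 0)" if "\<forall>x. x \<notin> I \<longrightarrow> f x = 0" "T f = (\<lambda>x. 0)" for f
      using discrete_div_grad_eq_0_imp_eq_0[OF assms that(1)] that(2)
      by (metis T_def)
  qed (auto simp: assms T_def fun_eq_iff discrete_div_def grad_add grad_scale bwd_add bwd_scale
      sum.distrib sum_distrib_left)
  then show thesis using that by (metis T_def)
qed

theorem theorem2p2:
  fixes \<Omega> :: "(real^3) set" and h :: real and u :: "real^3 \<Rightarrow> real^3"
  assumes "open \<Omega>" and "connected \<Omega>" and "bounded \<Omega>" and "lipschitz_boundary \<Omega>"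
    and "h > 0"
    and "u \<in> zero_extended (grid_domain h \<Omega>)"
  shows "\<exists>!(w :: real^3 \<Rightarrow> real^3, \<phi> :: real^3 \<Rightarrow> real).
      w \<in> zero_extended (grid_domain h \<Omega>) \<and> \<phi> \<in> zero_extended (grid_domain h \<Omega>) \<and>
      (\<forall>x \<in> grid_domain h \<Omega> - grid_boundary h (grid_domain h \<Omega>).
         discrete_div h w x = 0 \<and> w x + discrete_grad h \<phi> x = u x) \<and>
      (\<forall>x \<in> grid_boundary h (grid_domain h \<Omega>). w x = 0 \<and> \<phi> x = 0)"
proof -
  define G where "G = grid_domain h \<Omega>"
  define I where "I = G - grid_boundary h G"
  have "finite I" using finite_grid_domain[OF assms(3,5)] by (simp add: I_def G_def)
  have "grid_boundary h G \<subseteq> G" by (auto simp: grid_boundary_def)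
  \<comment> \<open>\<open>u\<close> may be nonzero on the grid boundary, where \<open>w\<close>
    must vanish, so only its cut-off enters the divergence.\<close>
  define uI where "uI x = (if x \<in> I then u x else 0)" for x
  define sol where "sol w \<phi> \<longleftrightarrow> w \<in> zero_extended G \<and> \<phi> \<in> zero_extended G \<and>
      (\<forall>x \<in> I. discrete_div h w x = 0 \<and> w x + discrete_grad h \<phi> x = u x) \<and>
      (\<forall>x \<in> grid_boundary h G. w x = 0 \<and> \<phi> x = 0)" for w \<phi>
  have sol_iff: "sol w \<phi> \<longleftrightarrow> (\<forall>x. x \<notin> I \<longrightarrow> \<phi> x = 0) \<and> w = (\<lambda>x. uI x - restrict_grad h I \<phi> x) \<and>
      (\<forall>x\<in>I. discrete_div h (restrict_grad h I \<phi>) x = discrete_div h uI x)" for w \<phi>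
  proof -
    \<comment> \<open>Vanishing off \<open>G\<close> and on its boundary together mean vanishing off
      \<open>I\<close>.\<close>
    have "sol w \<phi> \<longleftrightarrow> (\<forall>x. x \<notin> I \<longrightarrow> \<phi> x = 0) \<and> (\<forall>x. x \<notin> I \<longrightarrow> w x = 0) \<and>
        (\<forall>x\<in>I. w x = u x - discrete_grad h \<phi> x) \<and> (\<forall>x\<in>I. discrete_div h w x = 0)"
      using \<open>grid_boundary h G \<subseteq> G\<close> unfolding sol_def zero_extended_def I_def eq_diff_eq by blast
    also have "\<dots> \<longleftrightarrow> (\<forall>x. x \<notin> I \<longrightarrow> \<phi> x = 0) \<and> w = (\<lambda>x. uI x - restrict_grad h I \<phi> x) \<and>
        (\<forall>x\<in>I. discrete_div h w x = 0)"
      by (auto simp: fun_eq_iff uI_def restrict_grad_def)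
    \<comment> \<open>With \<open>w\<close> eliminated, linearity of the divergence leaves an
      equation for \<open>\<phi>\<close> alone.\<close>
    also have "\<dots> \<longleftrightarrow> (\<forall>x. x \<notin> I \<longrightarrow> \<phi> x = 0) \<and> w = (\<lambda>x. uI x - restrict_grad h I \<phi> x) \<and>
        (\<forall>x\<in>I. discrete_div h (restrict_grad h I \<phi>) x = discrete_div h uI x)"
      by (auto simp: discrete_div_diff)
    finally show ?thesis .
  qed
  obtain \<phi> where \<phi>: "\<forall>x. x \<notin> I \<longrightarrow> \<phi> x = 0"
    "\<forall>x\<in>I. discrete_div h (restrict_grad h I \<phi>) x = discrete_div h uI x"
    using discrete_div_grad_surj[OF \<open>finite I\<close> assms(5)] by blast
  have unique: "\<psi> = \<phi>" if \<psi>: "\<forall>x. x \<notin> I \<longrightarrow> \<psi> x = 0"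
    "\<forall>x\<in>I. discrete_div h (restrict_grad h I \<psi>) x = discrete_div h uI x" for \<psi>
  proof -
    \<comment> \<open>The difference of two solutions solves the homogeneous system.\<close>
    have "restrict_grad h I (\<lambda>x. \<psi> x - \<phi> x) = (\<lambda>x. restrict_grad h I \<psi> x - restrict_grad h I \<phi> x)"
      by (auto simp: fun_eq_iff restrict_grad_def discrete_grad_def fwd_diff_def vec_eq_iff
          diff_divide_distrib)
    then have "(\<lambda>x. \<psi> x - \<phi> x) = (\<lambda>x. 0)"
      using \<phi> \<psi> by (intro discrete_div_grad_eq_0_imp_eq_0[OF \<open>finite I\<close> assms(5)])
        (auto simp: discrete_div_diff)
    then show ?thesis by (auto simp: fun_eq_iff)
  qed
  have "\<exists>!(w, \<phi>). sol w \<phi>"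
  proof (rule ex1I)
    show "case (\<lambda>x. uI x - restrict_grad h I \<phi> x, \<phi>) of (w, \<phi>) \<Rightarrow> sol w \<phi>"
      using \<phi> by (simp add: sol_iff)
  next
    fix p assume "case p of (w, \<psi>) \<Rightarrow> sol w \<psi>"
    then obtain w \<psi> where p: "p = (w, \<psi>)" and sol: "sol w \<psi>" by (cases p) simp
    \<comment> \<open>Once the potentials agree, \<open>sol_iff\<close> expresses \<open>w\<close>
      through the potential, so the pairs agree.\<close>
    have "\<psi> = \<phi>" using sol unfolding sol_iff by (intro unique) blast+
    then show "p = (\<lambda>x. uI x - restrict_grad h I \<phi> x, \<phi>)"
      using sol unfolding sol_iff p by blast
  qed
  then show ?thesis unfolding sol_def I_def G_def .
qed

end
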